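(* Let $m,\kappa,k$ be positive integers with $\kappa>m\ge2$. Let $\eta_1,\dots,\eta_\kappa\in\{0,1,2,\dots\}\cup\{\infty\}$, not all zero, and let $X$, $\mathcal{F}$, $\phi$ be the associated one-circuit graph, power set and parent map described in the context. Let $M\in(0,\infty)$. For each $r\in J_{[1,\kappa]}$ let $\{w_i^r\}_{i=1}^{\eta_r}$ be a system of real polynomials of degree at most $m-2$, and for all $r\in J_{[1,\kappa]}$, $i\in J_{[1,\eta_r]}$ let $\{a^r_{i,j}\}_{j=1}^\infty\subset(0,\infty)$ be such that $$w_i^r(j)=a^r_{i,k+j}\quad\text{for all } r\in J_{[1,\kappa]},\ i\in J_{[1,\eta_r]},\ j\in\mathbb{N},$$ and $$\max_{r\in J_{[1,\kappa]}}\left\{\sum_{i=1}^{\eta_r}a^r_{i,1},\ \sup\left\{\frac{a^r_{i,j+1}}{a^r_{i,j}}: i\in J_{[1,\eta_r]},\ j\in\mathbb{N}\right\}\right\}\le M.$$ Then there exists a measure $\mu$ on $\mathcal{F}$ such that (1) $\mu(x^r_{i,j})=a^r_{i,j}$ for all $r\in J_{[1,\kappa]}$, $i\in J_{[1,\eta_r]}$, $j\in\mathbb{N}$; and (2) the corresponding composition operator $C_\phi\in B(L^2(\mu))$ is a $k$-quasi-$m$-isometry. Furthermore, there exists $c\in\mathbb{R}$ such that for every $t\in(c,\infty)$ there is a measure $\mu_t$ with the properties (1) and (2), of the form $$\mu_t(x)=\begin{cases}\mu(x)+t,& x=x_r\text{ for some } r\in J_{[1,\kappa]},\\ \mu(x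),&\text{otherwise.}\end{cases}$$
   Context: Notation: $\mathbb{N}=\{1,2,\dots\}$; $J_{[1,n]}=\{1,\dots,n\}$, with $J_{[1,0]}=\emptyset$ and $J_{[1,\infty]}=\mathbb{N}$. For a bounded operator $T$ on a complex Hilbert space, $\mathcal{B}_m(T)=\sum_{j=0}^{m}(-1)^j\binom{m}{j}T^{*(m-j)}T^{m-j}$; $T$ is a $k$-quasi-$m$-isometry if $T^{*k}\mathcal{B}_m(T)T^k=0$. Graph: given $\kappa\in\mathbb{N}$ and $\eta_1,\dots,\eta_\kappa\in\{0,1,2,\dots\}\cup\{\infty\}$, not all zero, let $X$ be the countable set consisting of the distinct points $x_1,\dots,x_\kappa$ together with the distinct points $x^r_{i,j}$, $r\in J_{[1,\kappa]}$, $i\in J_{[1,\eta_r]}$, $j\in\mathbb{N}$. Let $\mathcal{F}$ be the $\sigma$-algebra of all subsets of $X$. The map $\phi:X\to X$ (the parent map of the directed graph with circuit $x_1\to x_2\to\dots\to x_\kappa\to x_1$ and branches $x_r\to x^r_{i,1}\to x^r_{i,2}\to\cdots$) is $$\phi(x^r_{i,j+1})=x^r_{i,j},\quad \phi(x^r_{i,1})=x_r,\quad \phi(x_{r+1})=x_r\ (1\le r<\kappa),\quad \phi(x_1)=x_\kappa.$$ All measures $\mu$ on $\mathcal{F}$ are positive with $0<\mu(\{x\})<\infty$ for every $x\in X$, and $\mu(x)$ means $\mu(\{x\})$. The composition operator is $C_\phi f=f\circ\phi$ on $L^2(\mu)=L^2(X,\mathcal{F},\mu)$; $B(L^2(\mu))$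 is the algebra of bounded operators on $L^2(\mu)$. *)

theory Defs
  imports "HOL-Analysis.Analysis" "HOL-Computational_Algebra.Polynomial" "HOL-Library.Extended_Nat"
begin

section \<open>Operators on complex \<open>L\<^sup>2\<close> spaces\<close>

text \<open>
  Elements of \<open>L\<^sup>2(M)\<close> are represented by square-integrable functions, and equality in
  \<open>L\<^sup>2(M)\<close> is equality almost everywhere. Operators act on representatives; linearity up to null
  sets together with boundedness makes them compatible with almost-everywhere equality.
\<close>

definition L2 :: "'a measure \<Rightarrow> ('a \<Rightarrow> complex) set" where
  "L2 M = {f \<in> borel_measurable M. integrable M (\<lambda>x. (cmod (f x))\<^sup>2)}"

definition L2_inner :: "'a measure \<Rightarrow> ('a \<Rightarrow> complex) \<Rightarrow> ('a \<Rightarrow> complex) \<Rightarrow> complex" where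
  "L2_inner M f g = (LINT x|M. f x * cnj (g x))"

definition L2_norm :: "'a measure \<Rightarrow> ('a \<Rightarrow> complex) \<Rightarrow> real" where
  "L2_norm M f = sqrt (LINT x|M. (cmod (f x))\<^sup>2)"

definition bounded_operator_L2 :: "'a measure \<Rightarrow> (('a \<Rightarrow> complex) \<Rightarrow> ('a \<Rightarrow> complex)) \<Rightarrow> bool" where
  "bounded_operator_L2 M T \<longleftrightarrow>
     (\<forall>f\<in>L2 M. T f \<in> L2 M) \<and>
     (\<forall>f\<in>L2 M. \<forall>g\<in>L2 M. \<forall>a b. AE x in M. T (\<lambda>y. a * f y + b * g y) x = a * T f x + b * T g x) \<and>
     (\<exists>K. \<forall>f\<in>L2 M. L2_norm M (T f) \<le> K * L2_norm M f)"

text \<open>The adjoint of a bounded operator exists and is unique up to null sets; since every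
  use below is up to null sets, the choice of representative is immaterial.\<close>

definition L2_adjoint ::
    "'a measure \<Rightarrow> (('a \<Rightarrow> complex) \<Rightarrow> ('a \<Rightarrow> complex)) \<Rightarrow> (('a \<Rightarrow> complex) \<Rightarrow> ('a \<Rightarrow> complex))" where
  "L2_adjoint M T = (SOME S. bounded_operator_L2 M S \<and>
     (\<forall>f\<in>L2 M. \<forall>g\<in>L2 M. L2_inner M (T f) g = L2_inner M f (S g)))"

definition B_op ::
    "'a measure \<Rightarrow> nat \<Rightarrow> (('a \<Rightarrow> complex) \<Rightarrow> ('a \<Rightarrow> complex)) \<Rightarrow> (('a \<Rightarrow> complex) \<Rightarrow> ('a \<Rightarrow> complex))" where
  "B_op M m T f = (\<lambda>x. \<Sum>j=0..m. (-1) ^ j * of_nat (m choose j) *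
     (L2_adjoint M T ^^ (m - j)) ((T ^^ (m - j)) f) x)"

definition quasi_isometry_L2 ::
    "'a measure \<Rightarrow> nat \<Rightarrow> nat \<Rightarrow> (('a \<Rightarrow> complex) \<Rightarrow> ('a \<Rightarrow> complex)) \<Rightarrow> bool" where
  "quasi_isometry_L2 M k m T \<longleftrightarrow> bounded_operator_L2 M T \<and>
     (\<forall>f\<in>L2 M. AE x in M. (L2_adjoint M T ^^ k) (B_op M m T ((T ^^ k) f)) x = 0)"

definition composition_operator :: "('a \<Rightarrow> 'a) \<Rightarrow> ('a \<Rightarrow> complex) \<Rightarrow> ('a \<Rightarrow> complex)" where
  "composition_operator \<phi> f = f \<circ> \<phi>"


section \<open>The one-circuit graph\<close>

text \<open>\<open>J n\<close> is \<open>{1,\<dots>,n}\<close>, and the set of all positive integers if \<open>n = \<infinity>\<close>.\<close>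

definition J :: "enat \<Rightarrow> nat set" where
  "J n = {i. 1 \<le> i \<and> enat i \<le> n}"

text \<open>\<open>Circ r\<close> is \<open>x\<^sub>r\<close>, and \<open>Branch r i j\<close> is the \<open>j\<close>-th vertex of the \<open>i\<close>-th branch
  leaving \<open>x\<^sub>r\<close>; all indices start at 1.\<close>

datatype vertex = Circ nat | Branch nat nat nat

definition vertices :: "nat \<Rightarrow> (nat \<Rightarrow> enat) \<Rightarrow> vertex set" where
  "vertices \<kappa> \<eta> = {Circ r | r. r \<in> J \<kappa>} \<union>
     {Branch r i j | r i j. r \<in> J \<kappa> \<and> i \<in> J (\<eta> r) \<and> j \<in> J \<infinity>}"

definition parent :: "nat \<Rightarrow> vertex \<Rightarrow> vertex" where
  "parent \<kappa> v = (case v of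
       Circ r \<Rightarrow> if r = 1 then Circ \<kappa> else Circ (r - 1)
     | Branch r i j \<Rightarrow> if j = 1 then Circ r else Branch r i (j - 1))"

lemma parent_in_vertices: "v \<in> vertices \<kappa> \<eta> \<Longrightarrow> parent \<kappa> v \<in> vertices \<kappa> \<eta>"
  by (cases v) (auto simp: vertices_def parent_def J_def)

definition graph_measure :: "nat \<Rightarrow> (nat \<Rightarrow> enat) \<Rightarrow> vertex measure \<Rightarrow> bool" where
  "graph_measure \<kappa> \<eta> \<mu> \<longleftrightarrow> space \<mu> = vertices \<kappa> \<eta> \<and> sets \<mu> = Pow (vertices \<kappa> \<eta>) \<and>
     (\<forall>x\<in>vertices \<kappa> \<eta>. 0 < emeasure \<mu> {x} \<and> emeasure \<mu> {x} < \<infinity>)"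

end

theory Submission
  imports Defs
begin

text \<open>Write \<open>T\<close> for the composition operator of a self-map \<open>\<phi>\<close> of a discrete space with point masses
  \<open>\<mu>(x)\<close>. The \<open>n\<close>-th power of the adjoint, applied after \<open>T ^^ n\<close>, is multiplication by the
  function \<open>x \<mapsto> \<mu>((\<phi> ^^ n) -` {x}) / \<mu>(x)\<close>. Hence \<open>T\<close> is a \<open>k\<close>-quasi-\<open>m\<close>-isometry as soon as
  the \<open>m\<close>-th finite difference of \<open>n \<mapsto> \<mu>((\<phi> ^^ n) -` {x})\<close> vanishes at \<open>n = k\<close>, for every \<open>x\<close>
  (\<open>quasi_isometryI\<close>). The adjoint is given by weighted sums over fibres, and is bounded by the
  Cauchy--Schwarz inequality (\<open>fibre_Cauchy_Schwarz\<close>, \<open>A_adjoint\<close>).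

  For a branch vertex the iterated fibres are single points further out on the branch, and the
  condition is that the \<open>m\<close>-th difference of a polynomial of degree at most \<open>m - 2\<close> is zero. For a
  circuit vertex the fibre consists of one circuit vertex, with an unknown mass, and of branch
  vertices with prescribed masses (\<open>weight_fibre_Circ\<close>). The conditions at all circuit vertices
  form the linear system \<open>(fdiff ^^ m) c = b\<close> for a \<open>\<kappa>\<close>-periodic sequence \<open>c\<close> of circuit masses.
  It has a solution when \<open>b\<close> has mean zero (\<open>periodic_fdiff_solvable\<close>). Adding up the
  contributions of the branches over the circuit shows that this mean is an \<open>(m - 1)\<close>-st difference
  of sums of polynomials of degree at most \<open>m - 2\<close>, hence zero (\<open>sum_fdiff_branches_back\<close>). A
  solution stays a solution when a constant is added to it. This gives positive masses, and also the
  one-parameter family of measures \<open>\<mu>\<^sub>t\<close>.\<close>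

section \<open>Finite differences and their periodic solutions\<close>

text \<open>The forward difference of a real sequence. Its \<open>m\<close>-th iterate carries the signed binomial
  coefficients that occur in \<open>B_op\<close>.\<close>

definition fdiff :: "(nat \<Rightarrow> real) \<Rightarrow> nat \<Rightarrow> real" where
  "fdiff f n = f (Suc n) - f n"

lemma fdiff_funpow_Suc: "(fdiff ^^ Suc m) f n = (fdiff ^^ m) f (Suc n) - (fdiff ^^ m) f n"
  by (simp add: fdiff_def)

lemma fdiff_funpow_eq_sum:
  "(fdiff ^^ m) f n = (\<Sum>j=0..m. (-1) ^ j * real (m choose j) * f (n + (m - j)))"
proof (induction m arbitrary: n)
  case (Suc m)
  define g where "g j = f (n + (Suc m - j))" for j
  have "(\<Sum>j=0..Suc m. (-1) ^ j * real (Suc m choose j) * g j)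
      = g 0 + (\<Sum>j=0..m. (-1) ^ Suc j * real (Suc m choose Suc j) * g (Suc j))"
    by (subst sum.atLeast0_atMost_Suc_shift) simp
  also have "\<dots> = (g 0 + (\<Sum>j=0..m. (-1) ^ Suc j * real (m choose Suc j) * g (Suc j)))
      - (\<Sum>j=0..m. (-1) ^ j * real (m choose j) * g (Suc j))"
    by (simp add: algebra_simps sum.distrib sum_negf sum_subtractf)
  also have "g 0 + (\<Sum>j=0..m. (-1) ^ Suc j * real (m choose Suc j) * g (Suc j))
      = (\<Sum>j=0..Suc m. (-1) ^ j * real (m choose j) * g j)"
    by (simp add: sum.atLeast0_atMost_Suc_shift del: sum.atLeast0_atMost_Suc sum.cl_ivl_Suc)
  also have "\<dots> = (\<Sum>j=0..m. (-1) ^ j * real (m choose j) * g j)"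
    by simp
  also have "\<dots> = (\<Sum>j=0..m. (-1) ^ j * real (m choose j) * f (Suc n + (m - j)))"
    by (intro sum.cong) (auto simp: g_def Suc_diff_le)
  also have "\<dots> = (fdiff ^^ m) f (Suc n)"
    by (simp add: Suc.IH)
  also have "(\<Sum>j=0..m. (-1) ^ j * real (m choose j) * g (Suc j)) = (fdiff ^^ m) f n"
    by (simp add: Suc.IH g_def)
  finally show ?case
    by (simp only: fdiff_funpow_Suc g_def)
qed simp

lemma fdiff_funpow_shift: "(fdiff ^^ m) f (n + s) = (fdiff ^^ m) (\<lambda>i. f (i + s)) n"
  by (simp add: fdiff_funpow_eq_sum algebra_simps)

lemma fdiff_funpow_add: "(fdiff ^^ m) (\<lambda>i. f i + g i) n = (fdiff ^^ m) f n + (fdiff ^^ m) g n"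
  by (simp add: fdiff_funpow_eq_sum algebra_simps sum.distrib)

lemma fdiff_funpow_const: "m > 0 \<Longrightarrow> (fdiff ^^ m) (\<lambda>_. c) n = 0"
  by (cases m) (auto simp: fdiff_def funpow_Suc_right fdiff_funpow_eq_sum simp del: funpow.simps)

lemma fdiff_funpow_sum:
  "(fdiff ^^ m) (\<lambda>i. \<Sum>x\<in>S. f x i) n = (\<Sum>x\<in>S. (fdiff ^^ m) (f x) n)"
  unfolding fdiff_funpow_eq_sum sum_distrib_left by (rule sum.swap)

lemma has_sum_finite_sum:
  fixes f :: "'i \<Rightarrow> 'a \<Rightarrow> 'b :: topological_comm_monoid_add"
  assumes "\<And>j. j \<in> I \<Longrightarrow> (f j has_sum s j) S"
  shows "((\<lambda>x. \<Sum>j\<in>I. f j x) has_sum (\<Sum>j\<in>I. s j)) S"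
  using assms by (induction I rule: infinite_finite_induct) (auto intro: has_sum_add)

lemma fdiff_funpow_infsum:
  assumes "\<And>i. (\<lambda>x. f x i) summable_on S"
  shows "(fdiff ^^ m) (\<lambda>i. \<Sum>\<^sub>\<infinity>x\<in>S. f x i) n = (\<Sum>\<^sub>\<infinity>x\<in>S. (fdiff ^^ m) (f x) n)"
proof -
  have "((\<lambda>x. \<Sum>j=0..m. (-1) ^ j * real (m choose j) * f x (n + (m - j))) has_sum
      (\<Sum>j=0..m. (-1) ^ j * real (m choose j) * (\<Sum>\<^sub>\<infinity>x\<in>S. f x (n + (m - j))))) S"
    by (intro has_sum_finite_sum has_sum_cmult_right has_sum_infsum assms)
  then show ?thesis
    unfolding fdiff_funpow_eq_sum by (rule infsumI[symmetric])
qed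

lemma fdiff_funpow_poly:
  assumes "degree w < m"
  shows "(fdiff ^^ m) (\<lambda>i. poly w (real i)) n = 0"
  using assms
proof (induction m arbitrary: w)
  case (Suc m)
  define q where "q = pcompose w [:1, 1:] - w"
  have q: "fdiff (\<lambda>i. poly w (real i)) = (\<lambda>i. poly q (real i))"
    by (auto simp: fdiff_def q_def poly_pcompose algebra_simps)
  \<comment> \<open>The shift of the argument preserves the leading term, so \<open>q\<close> has smaller degree than \<open>w\<close>.\<close>
  show ?case
  proof (cases "degree w = 0")
    case True
    then obtain c where "w = [:c:]"
      by (auto elim: degree_eq_zeroE)
    then show ?thesis
      using fdiff_funpow_const[of "Suc m" c n] by simp
  next
    case False
    have "degree q < m"
    proof -
      have deg: "degree (pcompose w [:1, 1:]) = degree w"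
        by (simp add: degree_pcompose)
      have lead: "coeff (pcompose w [:1, 1:]) (degree w) = lead_coeff w"
        using lead_coeff_comp[of "[:1, 1::real:]" w] by (simp add: degree_pcompose)
      have "degree q \<le> degree w"
        unfolding q_def using deg by (intro degree_diff_le) auto
      moreover have "coeff q (degree w) = 0"
        by (simp add: q_def lead)
      ultimately have "degree q < degree w"
        using False by (metis degree_0 le_neq_implies_less leading_coeff_0_iff not_gr0)
      then show ?thesis
        using Suc.prems by simp
    qed
    from Suc.IH[OF this] show ?thesis
      by (simp add: funpow_Suc_right q del: funpow.simps)
  qed
qed simp

lemma sum_shift_periodic:
  fixes b :: "nat \<Rightarrow> real"
  assumes "\<And>n. b (n + \<kappa>) = b n"
  shows "(\<Sum>s<\<kappa>. b (s + t)) = (\<Sum>s<\<kappa>. b s)"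
proof (induction t)
  case (Suc t)
  have "(\<Sum>s<\<kappa>. b (s + Suc t)) + b t = (\<Sum>s<\<kappa>. b (s + t)) + b (\<kappa> + t)"
    using sum.lessThan_Suc_shift[of "\<lambda>s. b (s + t)" \<kappa>] by (simp add: algebra_simps)
  then show ?case
    using Suc assms[of t] by (simp add: add.commute)
qed simp

text \<open>Every \<open>\<kappa>\<close>-periodic sequence of mean zero is an iterated difference of a periodic sequence: its
  partial sums are again periodic, and subtracting their mean makes it possible to sum up once more.\<close>

lemma periodic_fdiff_solvable:
  fixes b :: "nat \<Rightarrow> real"
  assumes "\<kappa> > 0" "\<And>n. b (n + \<kappa>) = b n" "(\<Sum>s<\<kappa>. b s) = 0"
  shows "\<exists>c. (\<forall>n. c (n + \<kappa>) = c n) \<and> (\<forall>n. (fdiff ^^ m) c n = b n)"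
  using assms(2,3)
proof (induction m arbitrary: b)
  case (Suc m)
  define e where "e n = (\<Sum>i<n. b i)" for n
  define d where "d n = e n - (\<Sum>s<\<kappa>. e s) / real \<kappa>" for n
  have "e (n + \<kappa>) = e n" for n
    by (induction n) (use Suc.prems in \<open>auto simp: e_def\<close>)
  then have "d (n + \<kappa>) = d n" for n
    by (simp add: d_def)
  moreover have "(\<Sum>s<\<kappa>. d s) = 0"
    using \<open>\<kappa> > 0\<close> by (simp add: d_def sum_subtractf)
  ultimately obtain c where c: "\<forall>n. c (n + \<kappa>) = c n" "\<forall>n. (fdiff ^^ m) c n = d n"
    using Suc.IH by blast
  have "(fdiff ^^ Suc m) c n = b n" for n
    using c(2) by (simp add: fdiff_def d_def e_def)
  then show ?case
    using c(1) by blast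
qed auto

section \<open>Bounded composition operators over a weighted discrete set\<close>

text \<open>A set \<open>V\<close> with point masses \<open>p\<close> and a self-map \<open>\<phi>\<close> of \<open>V\<close> each of whose fibres has mass at most
  \<open>K\<close> times the mass of its base point. This bound makes \<open>f \<mapsto> f \<circ> \<phi>\<close> bounded on \<open>L\<^sup>2\<close>, with norm
  at most \<open>sqrt K\<close>.\<close>

locale bounded_symbol =
  fixes V :: "'a set" and p :: "'a \<Rightarrow> real" and \<phi> :: "'a \<Rightarrow> 'a" and K :: real
  assumes p_pos: "\<And>x. x \<in> V \<Longrightarrow> 0 < p x"
    and symbol_in: "\<And>x. x \<in> V \<Longrightarrow> \<phi> x \<in> V"
    and fibre_summable: "\<And>x. x \<in> V \<Longrightarrow> p summable_on (\<phi> -` {x} \<inter> V)"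
    and fibre_bound: "\<And>x. x \<in> V \<Longrightarrow> infsum p (\<phi> -` {x} \<inter> V) \<le> K * p x"
begin

text \<open>The measure on all subsets of \<open>V\<close> with point masses \<open>p\<close>.\<close>

definition \<mu> :: "'a measure" where
  "\<mu> = point_measure V (\<lambda>x. ennreal (p x))"

lemma space_mu [simp]: "space \<mu> = V"
  and sets_mu [simp]: "sets \<mu> = Pow V"
  by (auto simp: \<mu>_def space_point_measure sets_point_measure)

lemma emeasure_mu_singleton: "x \<in> V \<Longrightarrow> emeasure \<mu> {x} = ennreal (p x)"
  unfolding \<mu>_def by (subst emeasure_point_measure_finite2) auto

lemma measure_mu_singleton: "x \<in> V \<Longrightarrow> measure \<mu> {x} = p x"
  using p_pos[of x] by (simp add: measure_def emeasure_mu_singleton)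

lemma integrable_mu_iff:
  fixes f :: "'a \<Rightarrow> 'b :: {banach, second_countable_topology}"
  shows "integrable \<mu> f \<longleftrightarrow> (\<lambda>x. norm (p x *\<^sub>R f x)) summable_on V"
  unfolding abs_summable_equivalent Infinite_Set_Sum.abs_summable_on_def \<mu>_def point_measure_def
  by (subst integrable_density) (auto simp: AE_count_space p_pos less_imp_le)

lemma integral_mu_eq:
  fixes f :: "'a \<Rightarrow> 'b :: {banach, second_countable_topology}"
  assumes "integrable \<mu> f"
  shows "integral\<^sup>L \<mu> f = (\<Sum>\<^sub>\<infinity>x\<in>V. p x *\<^sub>R f x)"
proof -
  have "integral\<^sup>L \<mu> f = infsetsum (\<lambda>x. p x *\<^sub>R f x) V"
    unfolding infsetsum_def \<mu>_def point_measure_def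
    by (subst integral_density) (auto simp: AE_count_space p_pos less_imp_le)
  also have "\<dots> = (\<Sum>\<^sub>\<infinity>x\<in>V. p x *\<^sub>R f x)"
    using assms unfolding integrable_mu_iff abs_summable_equivalent
    by (rule infsetsum_infsum)
  finally show ?thesis .
qed

lemma L2_mu_iff: "f \<in> L2 \<mu> \<longleftrightarrow> (\<lambda>x. p x * (cmod (f x))\<^sup>2) summable_on V"
proof -
  have "integrable \<mu> (\<lambda>x. (cmod (f x))\<^sup>2) \<longleftrightarrow> (\<lambda>x. p x * (cmod (f x))\<^sup>2) summable_on V"
    unfolding integrable_mu_iff
    by (intro summable_on_cong) (use p_pos in \<open>auto simp: less_imp_le abs_mult\<close>)
  then show ?thesis
    by (simp add: L2_def \<mu>_def)
qed

lemma L2_norm_mu: "f \<in> L2 \<mu> \<Longrightarrow> L2_norm \<mu> f = sqrt (\<Sum>\<^sub>\<infinity>x\<in>V. p x * (cmod (f x))\<^sup>2)"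
  by (simp add: L2_norm_def L2_def integral_mu_eq)

lemma L2_mult_abs_summable:
  assumes "f \<in> L2 \<mu>" "g \<in> L2 \<mu>"
  shows "(\<lambda>x. norm (p x *\<^sub>R (f x * cnj (g x)))) summable_on V"
proof (rule Infinite_Sum.abs_summable_on_comparison_test')
  show "(\<lambda>x. p x * (cmod (f x))\<^sup>2 + p x * (cmod (g x))\<^sup>2) summable_on V"
    using assms by (intro summable_on_add) (auto simp: L2_mu_iff)
  fix x assume x: "x \<in> V"
  have "0 \<le> (cmod (f x) - cmod (g x))\<^sup>2" "0 \<le> cmod (f x) * cmod (g x)"
    by simp_all
  then have "cmod (f x) * cmod (g x) \<le> (cmod (f x))\<^sup>2 + (cmod (g x))\<^sup>2"
    unfolding power2_diff by linarith
  then have "p x * (cmod (f x) * cmod (g x)) \<le> p x * ((cmod (f x))\<^sup>2 + (cmod (g x))\<^sup>2)"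
    using p_pos[OF x] by (intro mult_left_mono) auto
  then show "norm (p x *\<^sub>R (f x * cnj (g x))) \<le> p x * (cmod (f x))\<^sup>2 + p x * (cmod (g x))\<^sup>2"
    using p_pos[OF x] by (simp add: norm_mult algebra_simps)
qed

lemmas L2_mult_summable = abs_summable_summable[OF L2_mult_abs_summable]

lemma L2_inner_mu:
  assumes "f \<in> L2 \<mu>" "g \<in> L2 \<mu>"
  shows "L2_inner \<mu> f g = (\<Sum>\<^sub>\<infinity>x\<in>V. p x *\<^sub>R (f x * cnj (g x)))"
  unfolding L2_inner_def
  by (rule integral_mu_eq) (simp only: integrable_mu_iff L2_mult_abs_summable[OF assms])

lemma L2_add:
  assumes "f \<in> L2 \<mu>" "g \<in> L2 \<mu>"
  shows "(\<lambda>x. f x + g x) \<in> L2 \<mu>"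
  unfolding L2_mu_iff
proof (rule summable_on_comparison_test)
  show "(\<lambda>x. 2 * (p x * (cmod (f x))\<^sup>2) + 2 * (p x * (cmod (g x))\<^sup>2)) summable_on V"
    using assms by (intro summable_on_add summable_on_cmult_right) (auto simp: L2_mu_iff)
  fix x assume x: "x \<in> V"
  have "(cmod (f x + g x))\<^sup>2 \<le> (cmod (f x) + cmod (g x))\<^sup>2"
    by (intro power_mono norm_triangle_ineq) auto
  also have "\<dots> \<le> 2 * (cmod (f x))\<^sup>2 + 2 * (cmod (g x))\<^sup>2"
    using zero_le_power2[of "cmod (f x) - cmod (g x)"] unfolding power2_diff power2_sum by linarith
  finally have "p x * (cmod (f x + g x))\<^sup>2 \<le> p x * (2 * (cmod (f x))\<^sup>2 + 2 * (cmod (g x))\<^sup>2)"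
    using p_pos[OF x] by (intro mult_left_mono) auto
  then show "p x * (cmod (f x + g x))\<^sup>2 \<le> 2 * (p x * (cmod (f x))\<^sup>2) + 2 * (p x * (cmod (g x))\<^sup>2)"
    by (simp add: algebra_simps)
  show "0 \<le> p x * (cmod (f x + g x))\<^sup>2"
    using p_pos[OF x] by simp
qed

lemma L2_cmult:
  assumes "f \<in> L2 \<mu>"
  shows "(\<lambda>x. c * f x) \<in> L2 \<mu>"
  using summable_on_cmult_right[of "\<lambda>x. p x * (cmod (f x))\<^sup>2" V "(cmod c)\<^sup>2"] assms
  by (simp add: L2_mu_iff norm_mult power_mult_distrib mult_ac)

lemma L2_zero: "(\<lambda>x. 0) \<in> L2 \<mu>"
  by (simp add: L2_mu_iff)

lemma L2_sum: "finite S \<Longrightarrow> (\<And>i. i \<in> S \<Longrightarrow> F i \<in> L2 \<mu>) \<Longrightarrow> (\<lambda>x. \<Sum>i\<in>S. F i x) \<in> L2 \<mu>"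
  by (induction S rule: finite_induct) (auto simp: L2_zero L2_add)

lemma L2_delta: "(\<lambda>y. of_bool (y = x)) \<in> L2 \<mu>"
  unfolding L2_mu_iff
  by (rule has_sum_imp_summable[OF has_sum_finite_neutralI[where B = "{x} \<inter> V"]]) auto

abbreviation T where "T \<equiv> composition_operator \<phi>"

abbreviation fibre where "fibre x \<equiv> \<phi> -` {x} \<inter> V"

text \<open>Sums over \<open>V\<close> are rearranged along the partition of \<open>V\<close> into the fibres of \<open>\<phi>\<close>.\<close>

lemma bij_fibres: "bij_betw snd (Sigma V fibre) V"
  unfolding bij_betw_def inj_on_def using symbol_in by (force simp: image_iff)

lemma summable_on_fibres_iff:
  "f summable_on V \<longleftrightarrow> (\<lambda>z. f (snd z)) summable_on Sigma V fibre"
  using summable_on_reindex_bij_betw[OF bij_fibres, of f] by simp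

lemma infsum_fibres:
  fixes f :: "'a \<Rightarrow> 'b :: banach"
  assumes "f summable_on V"
  shows "(\<Sum>\<^sub>\<infinity>x\<in>V. \<Sum>\<^sub>\<infinity>y\<in>fibre x. f y) = infsum f V"
  using infsum_Sigma_banach[of "\<lambda>z. f (snd z)" V fibre] assms
  by (simp add: summable_on_fibres_iff infsum_reindex_bij_betw[OF bij_fibres])

lemma infsum_fibres_summable:
  fixes f :: "'a \<Rightarrow> 'b :: banach"
  assumes "f summable_on V"
  shows "(\<lambda>x. \<Sum>\<^sub>\<infinity>y\<in>fibre x. f y) summable_on V"
  using summable_on_Sigma_banach[of "\<lambda>x y. f y" V fibre] assms
  by (simp add: summable_on_fibres_iff case_prod_unfold)

lemma composition_L2:
  assumes f: "f \<in> L2 \<mu>"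
  shows "T f \<in> L2 \<mu>"
    and "(\<Sum>\<^sub>\<infinity>y\<in>V. p y * (cmod (T f y))\<^sup>2) \<le> K * (\<Sum>\<^sub>\<infinity>x\<in>V. p x * (cmod (f x))\<^sup>2)"
proof -
  have hs: "((\<lambda>y. p y * (cmod (T f y))\<^sup>2) has_sum (infsum p (fibre x) * (cmod (f x))\<^sup>2)) (fibre x)"
    if "x \<in> V" for x
  proof -
    have "((\<lambda>y. p y * (cmod (f x))\<^sup>2) has_sum (infsum p (fibre x) * (cmod (f x))\<^sup>2)) (fibre x)"
      by (intro has_sum_cmult_left has_sum_infsum fibre_summable that)
    then show ?thesis
      by (rule has_sum_cong[THEN iffD1, rotated]) (auto simp: composition_operator_def)
  qed
  have le: "infsum p (fibre x) * (cmod (f x))\<^sup>2 \<le> K * (p x * (cmod (f x))\<^sup>2)" if "x \<in> V" for x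
    using mult_right_mono[OF fibre_bound[OF that], of "(cmod (f x))\<^sup>2"] by (simp add: mult_ac)
  have Kf: "(\<lambda>x. K * (p x * (cmod (f x))\<^sup>2)) summable_on V"
    using f by (intro summable_on_cmult_right) (simp add: L2_mu_iff)
  have sm: "(\<lambda>x. infsum p (fibre x) * (cmod (f x))\<^sup>2) summable_on V"
    by (rule summable_on_comparison_test[OF Kf le])
       (auto intro!: mult_nonneg_nonneg infsum_nonneg simp: p_pos less_imp_le)
  have "(\<lambda>z. p (snd z) * (cmod (T f (snd z)))\<^sup>2) summable_on Sigma V fibre"
    by (rule summable_on_SigmaI[OF _ sm]) (use hs in \<open>auto simp: p_pos less_imp_le\<close>)
  then have smT: "(\<lambda>y. p y * (cmod (T f y))\<^sup>2) summable_on V"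
    using summable_on_fibres_iff by blast
  then show "T f \<in> L2 \<mu>"
    by (simp add: L2_mu_iff)
  have "(\<Sum>\<^sub>\<infinity>y\<in>V. p y * (cmod (T f y))\<^sup>2) = (\<Sum>\<^sub>\<infinity>x\<in>V. infsum p (fibre x) * (cmod (f x))\<^sup>2)"
    unfolding infsum_fibres[OF smT, symmetric] by (intro infsum_cong infsumI hs)
  also have "\<dots> \<le> (\<Sum>\<^sub>\<infinity>x\<in>V. K * (p x * (cmod (f x))\<^sup>2))"
    by (rule infsum_mono[OF sm Kf le])
  also have "\<dots> = K * (\<Sum>\<^sub>\<infinity>x\<in>V. p x * (cmod (f x))\<^sup>2)"
    by (rule infsum_cmult_right')
  finally show "(\<Sum>\<^sub>\<infinity>y\<in>V. p y * (cmod (T f y))\<^sup>2) \<le> K * (\<Sum>\<^sub>\<infinity>x\<in>V. p x * (cmod (f x))\<^sup>2)" .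
qed

lemma bounded_operator_L2I:
  assumes "\<And>f. f \<in> L2 \<mu> \<Longrightarrow> S f \<in> L2 \<mu>"
    and "\<And>f. f \<in> L2 \<mu> \<Longrightarrow>
      (\<Sum>\<^sub>\<infinity>x\<in>V. p x * (cmod (S f x))\<^sup>2) \<le> K * (\<Sum>\<^sub>\<infinity>x\<in>V. p x * (cmod (f x))\<^sup>2)"
    and "\<And>f g a b x. f \<in> L2 \<mu> \<Longrightarrow> g \<in> L2 \<mu> \<Longrightarrow> x \<in> V \<Longrightarrow>
      S (\<lambda>y. a * f y + b * g y) x = a * S f x + b * S g x"
  shows "bounded_operator_L2 \<mu> S"
proof -
  have "L2_norm \<mu> (S f) \<le> sqrt K * L2_norm \<mu> f" if "f \<in> L2 \<mu>" for f
    using assms(2)[OF that] that assms(1)[OF that]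
    by (simp add: L2_norm_mu real_sqrt_mult[symmetric])
  moreover have "AE x in \<mu>. S (\<lambda>y. a * f y + b * g y) x = a * S f x + b * S g x"
    if "f \<in> L2 \<mu>" "g \<in> L2 \<mu>" for f g a b
    using assms(3)[OF that] by (intro AE_I2) auto
  ultimately show ?thesis
    unfolding bounded_operator_L2_def using assms(1) by blast
qed

lemma bounded_composition: "bounded_operator_L2 \<mu> T"
  using composition_L2 by (intro bounded_operator_L2I) (auto simp: composition_operator_def)

text \<open>The adjoint of the composition operator: the \<open>p\<close>-weighted sum over the fibre, divided by the
  mass of the base point.\<close>

definition A :: "('a \<Rightarrow> complex) \<Rightarrow> 'a \<Rightarrow> complex" where
  "A g x = (\<Sum>\<^sub>\<infinity>y\<in>fibre x. p y *\<^sub>R g y) /\<^sub>R p x"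

lemma fibre_weighted_abs_summable:
  assumes "g \<in> L2 \<mu>" "x \<in> V"
  shows "(\<lambda>y. norm (p y *\<^sub>R g y)) summable_on fibre x"
proof (rule Infinite_Sum.abs_summable_on_comparison_test')
  show "(\<lambda>y. p y + p y * (cmod (g y))\<^sup>2) summable_on fibre x"
    using assms by (intro summable_on_add fibre_summable)
      (auto simp: L2_mu_iff intro: summable_on_subset_banach)
  fix y assume y: "y \<in> fibre x"
  have "cmod (g y) \<le> 1 + (cmod (g y))\<^sup>2"
    using zero_le_power2[of "cmod (g y) - 1"] norm_ge_zero[of "g y"]
    unfolding power2_diff power_one mult_1_right by linarith
  then have "p y * cmod (g y) \<le> p y * (1 + (cmod (g y))\<^sup>2)"
    using y p_pos[of y] by (intro mult_left_mono) auto
  then show "norm (p y *\<^sub>R g y) \<le> p y + p y * (cmod (g y))\<^sup>2"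
    using y p_pos[of y] by (simp add: algebra_simps)
qed

lemmas fibre_weighted_summable = abs_summable_summable[OF fibre_weighted_abs_summable]

text \<open>The Cauchy--Schwarz inequality on a single fibre. Summed over all fibres it bounds the adjoint
  in norm.\<close>

lemma fibre_Cauchy_Schwarz:
  assumes g: "g \<in> L2 \<mu>" and x: "x \<in> V"
  shows "p x * (cmod (A g x))\<^sup>2 \<le> K * (\<Sum>\<^sub>\<infinity>y\<in>fibre x. p y * (cmod (g y))\<^sup>2)"
proof -
  define N where "N = infsum p (fibre x)"
  define G where "G = (\<Sum>\<^sub>\<infinity>y\<in>fibre x. p y * (cmod (g y))\<^sup>2)"
  define s where "s = (\<Sum>\<^sub>\<infinity>y\<in>fibre x. p y * cmod (g y))"
  have pos: "p y > 0" if "y \<in> fibre x" for y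
    using that p_pos by auto
  have s_eq: "s = (\<Sum>\<^sub>\<infinity>y\<in>fibre x. norm (p y *\<^sub>R g y))"
    unfolding s_def by (intro infsum_cong) (use pos in \<open>auto simp: less_imp_le\<close>)
  have s_summable: "(\<lambda>y. p y * cmod (g y)) summable_on fibre x"
    using fibre_weighted_abs_summable[OF g x]
    by (rule summable_on_cong[THEN iffD1, rotated]) (use pos in \<open>auto simp: less_imp_le\<close>)
  have G_summable: "(\<lambda>y. p y * (cmod (g y))\<^sup>2) summable_on fibre x"
    using g by (auto simp: L2_mu_iff intro: summable_on_subset_banach)
  have s0: "s \<ge> 0" and G0: "G \<ge> 0"
    unfolding s_def G_def by (intro infsum_nonneg; use pos in \<open>auto simp: less_imp_le\<close>)+
  have N: "N \<ge> 0" "N \<le> K * p x"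
    unfolding N_def using fibre_bound[OF x]
    by (auto intro!: infsum_nonneg less_imp_le[OF pos])
  \<comment> \<open>A quadratic in \<open>t\<close> that is nonnegative everywhere. For \<open>N > 0\<close> take \<open>t = s / N\<close>; for \<open>N = 0\<close>
    a large \<open>t\<close> forces \<open>s = 0\<close>.\<close>
  have quad: "2 * t * s \<le> t\<^sup>2 * N + G" for t
  proof -
    have "2 * t * s = (\<Sum>\<^sub>\<infinity>y\<in>fibre x. 2 * t * (p y * cmod (g y)))"
      unfolding s_def by (rule infsum_cmult_right'[symmetric])
    also have "\<dots> \<le> (\<Sum>\<^sub>\<infinity>y\<in>fibre x. t\<^sup>2 * p y + p y * (cmod (g y))\<^sup>2)"
    proof (rule infsum_mono)
      fix y assume y: "y \<in> fibre x"
      have "p y * (2 * t * cmod (g y)) \<le> p y * (t\<^sup>2 + (cmod (g y))\<^sup>2)"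
        using zero_le_power2[of "t - cmod (g y)"] pos[OF y]
        unfolding power2_diff by (intro mult_left_mono) auto
      then show "2 * t * (p y * cmod (g y)) \<le> t\<^sup>2 * p y + p y * (cmod (g y))\<^sup>2"
        by (simp add: algebra_simps)
    qed (intro summable_on_add summable_on_cmult_right s_summable G_summable fibre_summable x)+
    also have "\<dots> = t\<^sup>2 * N + G"
      unfolding N_def G_def
      by (subst infsum_add) (auto simp: infsum_cmult_right' intro!: summable_on_cmult_right G_summable fibre_summable x)
    finally show ?thesis .
  qed
  have "s\<^sup>2 \<le> N * G"
  proof (cases "N = 0")
    case True
    have "s = 0"
    proof (rule ccontr)
      assume "s \<noteq> 0"
      then show False
        using quad[of "(G + 1) / (2 * s)"] True by simp
    qed
    then show ?thesis by (simp add: True)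
  next
    case False
    with N have Npos: "N > 0" by simp
    have "2 * (s / N) * s \<le> (s / N)\<^sup>2 * N + G"
      by (rule quad)
    then show ?thesis
      using Npos by (simp add: field_simps power2_eq_square)
  qed
  also have "\<dots> \<le> K * p x * G"
    using N G0 by (intro mult_right_mono) auto
  finally have sK: "s\<^sup>2 \<le> K * p x * G" .
  have "cmod (A g x) \<le> s / p x"
    using norm_infsum_bound[OF fibre_weighted_abs_summable[OF g x]] p_pos[OF x]
    unfolding A_def s_eq by (simp add: field_simps)
  then have "(cmod (A g x))\<^sup>2 \<le> (s / p x)\<^sup>2"
    by (intro power_mono) auto
  also have "\<dots> \<le> K * p x * G / (p x)\<^sup>2"
    using sK by (simp add: power_divide divide_right_mono)
  finally have "p x * (cmod (A g x))\<^sup>2 \<le> p x * (K * p x * G / (p x)\<^sup>2)"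
    using p_pos[OF x] by (intro mult_left_mono) auto
  also have "\<dots> = K * G"
    using p_pos[OF x] by (simp add: power2_eq_square)
  finally show ?thesis
    by (simp add: G_def)
qed

lemma A_L2:
  assumes g: "g \<in> L2 \<mu>"
  shows "A g \<in> L2 \<mu>"
    and "(\<Sum>\<^sub>\<infinity>x\<in>V. p x * (cmod (A g x))\<^sup>2) \<le> K * (\<Sum>\<^sub>\<infinity>x\<in>V. p x * (cmod (g x))\<^sup>2)"
proof -
  have g': "(\<lambda>y. p y * (cmod (g y))\<^sup>2) summable_on V"
    using g by (simp add: L2_mu_iff)
  have sm: "(\<lambda>x. K * (\<Sum>\<^sub>\<infinity>y\<in>fibre x. p y * (cmod (g y))\<^sup>2)) summable_on V"
    by (intro summable_on_cmult_right infsum_fibres_summable g')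
  have smA: "(\<lambda>x. p x * (cmod (A g x))\<^sup>2) summable_on V"
    by (rule summable_on_comparison_test[OF sm fibre_Cauchy_Schwarz[OF g]])
       (auto simp: p_pos less_imp_le)
  then show "A g \<in> L2 \<mu>"
    by (simp add: L2_mu_iff)
  have "(\<Sum>\<^sub>\<infinity>x\<in>V. p x * (cmod (A g x))\<^sup>2)
      \<le> (\<Sum>\<^sub>\<infinity>x\<in>V. K * (\<Sum>\<^sub>\<infinity>y\<in>fibre x. p y * (cmod (g y))\<^sup>2))"
    by (rule infsum_mono[OF smA sm fibre_Cauchy_Schwarz[OF g]])
  also have "\<dots> = K * (\<Sum>\<^sub>\<infinity>x\<in>V. p x * (cmod (g x))\<^sup>2)"
    by (simp add: infsum_cmult_right' infsum_fibres[OF g'])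
  finally show "(\<Sum>\<^sub>\<infinity>x\<in>V. p x * (cmod (A g x))\<^sup>2) \<le> K * (\<Sum>\<^sub>\<infinity>x\<in>V. p x * (cmod (g x))\<^sup>2)" .
qed

lemma A_linear:
  assumes "f \<in> L2 \<mu>" "g \<in> L2 \<mu>" "x \<in> V"
  shows "A (\<lambda>y. a * f y + b * g y) x = a * A f x + b * A g x"
proof -
  have f: "((\<lambda>y. p y *\<^sub>R f y) has_sum (\<Sum>\<^sub>\<infinity>y\<in>fibre x. p y *\<^sub>R f y)) (fibre x)"
    and g: "((\<lambda>y. p y *\<^sub>R g y) has_sum (\<Sum>\<^sub>\<infinity>y\<in>fibre x. p y *\<^sub>R g y)) (fibre x)"
    by (intro has_sum_infsum fibre_weighted_summable assms)+
  have "((\<lambda>y. a * (p y *\<^sub>R f y) + b * (p y *\<^sub>R g y)) has_sum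
      (a * (\<Sum>\<^sub>\<infinity>y\<in>fibre x. p y *\<^sub>R f y) + b * (\<Sum>\<^sub>\<infinity>y\<in>fibre x. p y *\<^sub>R g y))) (fibre x)"
    by (rule has_sum_add[OF has_sum_cmult_right[OF f] has_sum_cmult_right[OF g]])
  then have "(\<Sum>\<^sub>\<infinity>y\<in>fibre x. p y *\<^sub>R (a * f y + b * g y))
      = a * (\<Sum>\<^sub>\<infinity>y\<in>fibre x. p y *\<^sub>R f y) + b * (\<Sum>\<^sub>\<infinity>y\<in>fibre x. p y *\<^sub>R g y)"
    by (intro infsumI) (simp add: scaleR_add_right)
  then show ?thesis
    by (simp add: A_def scaleR_add_right)
qed

lemma A_adjoint:
  assumes f: "f \<in> L2 \<mu>" and g: "g \<in> L2 \<mu>"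
  shows "L2_inner \<mu> (T f) g = L2_inner \<mu> f (A g)"
proof -
  have sm: "(\<lambda>y. p y *\<^sub>R (T f y * cnj (g y))) summable_on V"
    by (intro L2_mult_summable composition_L2 f g)
  have "(\<Sum>\<^sub>\<infinity>y\<in>fibre x. p y *\<^sub>R (T f y * cnj (g y))) = p x *\<^sub>R (f x * cnj (A g x))" if "x \<in> V" for x
  proof -
    have "(\<Sum>\<^sub>\<infinity>y\<in>fibre x. p y *\<^sub>R (T f y * cnj (g y)))
        = (\<Sum>\<^sub>\<infinity>y\<in>fibre x. f x * cnj (p y *\<^sub>R g y))"
      by (intro infsum_cong) (auto simp: composition_operator_def)
    also have "\<dots> = f x * cnj (\<Sum>\<^sub>\<infinity>y\<in>fibre x. p y *\<^sub>R g y)"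
      by (simp only: infsum_cmult_right' infsum_cnj)
    also have "(\<Sum>\<^sub>\<infinity>y\<in>fibre x. p y *\<^sub>R g y) = p x *\<^sub>R A g x"
      using p_pos[OF that] by (simp add: A_def)
    finally show ?thesis by simp
  qed
  then show ?thesis
    using infsum_fibres[OF sm] composition_L2(1)[OF f] A_L2(1)[OF g] f g
    by (simp add: L2_inner_mu cong: infsum_cong)
qed

text \<open>Once one bounded adjoint is known to exist, the operator selected by \<open>L2_adjoint\<close> is bounded and
  adjoint to \<open>T\<close> as well. Nothing else about it is used below.\<close>

lemma L2_adjoint_composition:
  "bounded_operator_L2 \<mu> (L2_adjoint \<mu> T)"
  "\<lbrakk>f \<in> L2 \<mu>; g \<in> L2 \<mu>\<rbrakk> \<Longrightarrow> L2_inner \<mu> (T f) g = L2_inner \<mu> f (L2_adjoint \<mu> T g)"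
proof -
  have "bounded_operator_L2 \<mu> A"
    by (intro bounded_operator_L2I A_L2 A_linear)
  then have "\<exists>S. bounded_operator_L2 \<mu> S \<and>
      (\<forall>f\<in>L2 \<mu>. \<forall>g\<in>L2 \<mu>. L2_inner \<mu> (T f) g = L2_inner \<mu> f (S g))"
    using A_adjoint by blast
  from someI_ex[OF this]
  show "bounded_operator_L2 \<mu> (L2_adjoint \<mu> T)"
    "\<lbrakk>f \<in> L2 \<mu>; g \<in> L2 \<mu>\<rbrakk> \<Longrightarrow> L2_inner \<mu> (T f) g = L2_inner \<mu> f (L2_adjoint \<mu> T g)"
    unfolding L2_adjoint_def by auto
qed

abbreviation S where "S \<equiv> L2_adjoint \<mu> T"

lemma S_funpow_L2: "g \<in> L2 \<mu> \<Longrightarrow> (S ^^ n) g \<in> L2 \<mu>"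
  using L2_adjoint_composition(1) by (induction n) (auto simp: bounded_operator_L2_def)

lemma T_funpow_L2: "f \<in> L2 \<mu> \<Longrightarrow> (T ^^ n) f \<in> L2 \<mu>"
  using composition_L2(1) by (induction n) auto

lemma funpow_adjoint:
  assumes "f \<in> L2 \<mu>" "g \<in> L2 \<mu>"
  shows "L2_inner \<mu> ((T ^^ n) f) g = L2_inner \<mu> f ((S ^^ n) g)"
  using assms
proof (induction n arbitrary: f)
  case (Suc n)
  have "L2_inner \<mu> ((T ^^ Suc n) f) g = L2_inner \<mu> (T f) ((S ^^ n) g)"
    using Suc.IH[of "T f"] Suc.prems composition_L2(1)
    by (simp add: funpow_Suc_right del: funpow.simps)
  also have "\<dots> = L2_inner \<mu> f ((S ^^ Suc n) g)"
    using Suc.prems by (simp add: L2_adjoint_composition(2) S_funpow_L2)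
  finally show ?case .
qed simp

lemma T_funpow: "(T ^^ n) f = f \<circ> (\<phi> ^^ n)"
  by (induction n) (simp_all add: composition_operator_def fun_eq_iff funpow_swap1[of \<phi>])

text \<open>Pairing with the indicator of a point recovers the value of a function at that point.\<close>

lemma L2_inner_delta:
  assumes "g \<in> L2 \<mu>" "x \<in> V"
  shows "L2_inner \<mu> (\<lambda>y. of_bool (y = x)) g = p x *\<^sub>R cnj (g x)"
proof -
  have "((\<lambda>y. p y *\<^sub>R (of_bool (y = x) * cnj (g y))) has_sum p x *\<^sub>R cnj (g x)) V"
    using assms by (intro has_sum_finite_neutralI[where B = "{x}"]) auto
  then show ?thesis
    using assms by (simp add: L2_inner_mu L2_delta infsumI)
qed

text \<open>The composite of the \<open>n\<close>-th power of the adjoint with \<open>T ^^ n\<close> is multiplication by the mass of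
  the \<open>n\<close>-th fibre relative to the mass of its base point. This is the weak form of that fact.\<close>

lemma L2_inner_funpow_delta:
  assumes "f \<in> L2 \<mu>"
  shows "L2_inner \<mu> ((T ^^ n) (\<lambda>y. of_bool (y = x))) ((T ^^ n) f)
      = of_real (infsum p ((\<phi> ^^ n) -` {x} \<inter> V)) * cnj (f x)"
proof -
  have "L2_inner \<mu> ((T ^^ n) (\<lambda>y. of_bool (y = x))) ((T ^^ n) f)
      = (\<Sum>\<^sub>\<infinity>y\<in>V. p y *\<^sub>R ((T ^^ n) (\<lambda>y. of_bool (y = x)) y * cnj ((T ^^ n) f y)))"
    by (intro L2_inner_mu T_funpow_L2 L2_delta assms)
  also have "\<dots> = (\<Sum>\<^sub>\<infinity>y\<in>(\<phi> ^^ n) -` {x} \<inter> V. of_real (p y) * cnj (f x))"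
    by (rule infsum_cong_neutral) (auto simp: T_funpow scaleR_conv_of_real)
  also have "\<dots> = of_real (infsum p ((\<phi> ^^ n) -` {x} \<inter> V)) * cnj (f x)"
    unfolding infsum_cmult_left'
    by (subst infsum_bounded_linear_strong[OF summable_on_bounded_linear_iff[OF bounded_linear_of_real bounded_linear_Re]])
       (auto intro: bounded_linear_of_real)
  finally show ?thesis .
qed

text \<open>The defining identity of a \<open>k\<close>-quasi-\<open>m\<close>-isometry is tested against indicators of points,
  where it becomes an identity between masses of iterated fibres.\<close>

lemma quasi_isometryI:
  assumes "\<And>x. x \<in> V \<Longrightarrow>
    (\<Sum>j=0..m. (-1) ^ j * real (m choose j) * infsum p ((\<phi> ^^ (k + (m - j))) -` {x} \<inter> V)) = 0"
  shows "quasi_isometry_L2 \<mu> k m T"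
proof -
  have "(S ^^ k) (B_op \<mu> m T ((T ^^ k) f)) x = 0" if f: "f \<in> L2 \<mu>" and x: "x \<in> V" for f x
  proof -
    define e :: "'a \<Rightarrow> complex" where "e = (\<lambda>y. of_bool (y = x))"
    have e: "e \<in> L2 \<mu>"
      by (simp add: e_def L2_delta)
    define F where "F j = (S ^^ (m - j)) ((T ^^ (m - j)) ((T ^^ k) f))" for j
    have F: "F j \<in> L2 \<mu>" for j
      unfolding F_def by (intro S_funpow_L2 T_funpow_L2 f)
    have B: "B_op \<mu> m T ((T ^^ k) f) = (\<lambda>y. \<Sum>j=0..m. ((-1) ^ j * of_nat (m choose j)) * F j y)"
      by (simp add: B_op_def F_def)
    have BL2: "B_op \<mu> m T ((T ^^ k) f) \<in> L2 \<mu>"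
      unfolding B by (intro L2_sum L2_cmult F) auto
    have inner_F: "L2_inner \<mu> ((T ^^ k) e) (F j)
        = of_real (infsum p ((\<phi> ^^ (k + (m - j))) -` {x} \<inter> V)) * cnj (f x)" for j
    proof -
      have "L2_inner \<mu> ((T ^^ k) e) (F j)
          = L2_inner \<mu> ((T ^^ (m - j)) ((T ^^ k) e)) ((T ^^ (m - j)) ((T ^^ k) f))"
        unfolding F_def by (intro funpow_adjoint[symmetric] T_funpow_L2 e f)
      also have "\<dots> = L2_inner \<mu> ((T ^^ (k + (m - j))) e) ((T ^^ (k + (m - j))) f)"
        by (simp add: add.commute[of k] funpow_add)
      finally show ?thesis
        unfolding e_def by (simp add: L2_inner_funpow_delta[OF f])
    qed
    have "p x *\<^sub>R cnj ((S ^^ k) (B_op \<mu> m T ((T ^^ k) f)) x)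
        = L2_inner \<mu> e ((S ^^ k) (B_op \<mu> m T ((T ^^ k) f)))"
      unfolding e_def by (rule L2_inner_delta[symmetric]) (intro S_funpow_L2 BL2 x)+
    also have "\<dots> = L2_inner \<mu> ((T ^^ k) e) (B_op \<mu> m T ((T ^^ k) f))"
      by (rule funpow_adjoint[symmetric, OF e BL2])
    also have "\<dots> = (\<Sum>\<^sub>\<infinity>y\<in>V. \<Sum>j=0..m. ((-1) ^ j * of_nat (m choose j)) *
        (p y *\<^sub>R ((T ^^ k) e y * cnj (F j y))))"
      unfolding L2_inner_mu[OF T_funpow_L2[OF e] BL2]
      by (simp add: B sum_distrib_left scaleR_sum_right mult_ac)
    also have "\<dots> = (\<Sum>j=0..m. ((-1) ^ j * of_nat (m choose j)) * L2_inner \<mu> ((T ^^ k) e) (F j))"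
      unfolding L2_inner_mu[OF T_funpow_L2[OF e] F]
      by (intro infsumI has_sum_finite_sum has_sum_cmult_right has_sum_infsum
          L2_mult_summable T_funpow_L2 e F)
    also have "\<dots> = of_real (\<Sum>j=0..m. (-1) ^ j * real (m choose j) *
        infsum p ((\<phi> ^^ (k + (m - j))) -` {x} \<inter> V)) * cnj (f x)"
      by (simp add: inner_F sum_distrib_left sum_distrib_right mult_ac)
    also have "\<dots> = 0"
      by (simp only: assms[OF x]) simp
    finally show ?thesis
      using p_pos[OF x] by simp
  qed
  then show ?thesis
    unfolding quasi_isometry_L2_def using bounded_composition by (auto intro!: AE_I2)
qed

end

section \<open>Measures on the one-circuit graph\<close>

lemma J_enat_iff: "r \<in> J (enat \<kappa>) \<longleftrightarrow> 1 \<le> r \<and> r \<le> \<kappa>"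
  by (simp add: J_def)

lemma J_infinity_iff: "j \<in> J \<infinity> \<longleftrightarrow> 1 \<le> j"
  by (simp add: J_def)

text \<open>The graph with branch masses \<open>a\<close>. The first vertices of the branches at \<open>x\<^sub>r\<close> have finite total mass
  and the masses along a branch grow at most by the factor \<open>M\<close>, so the
  vertices at any fixed distance from \<open>x\<^sub>r\<close> have finite total mass.\<close>

locale one_circuit =
  fixes \<kappa> :: nat and \<eta> :: "nat \<Rightarrow> enat" and a :: "nat \<Rightarrow> nat \<Rightarrow> nat \<Rightarrow> real" and M :: real
  assumes kappa_pos: "0 < \<kappa>"
    and M_nonneg: "0 \<le> M"
    and a_pos: "\<lbrakk>r \<in> J \<kappa>; i \<in> J (\<eta> r); 1 \<le> j\<rbrakk> \<Longrightarrow> 0 < a r i j"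
    and a_ratio: "\<lbrakk>r \<in> J \<kappa>; i \<in> J (\<eta> r); 1 \<le> j\<rbrakk> \<Longrightarrow> a r i (Suc j) \<le> M * a r i j"
    and a_1_summable: "r \<in> J \<kappa> \<Longrightarrow> (\<lambda>i. a r i 1) summable_on J (\<eta> r)"
begin

abbreviation V where "V \<equiv> vertices \<kappa> \<eta>"

text \<open>The circuit index in \<open>{1..\<kappa>}\<close> that is reached by counting on from \<open>1\<close>: the circuit is unrolled to
  \<open>0, 1, 2, \<dots>\<close>, with \<open>s\<close> standing for the vertex \<open>Circ (cyc s)\<close>. In particular \<open>Circ r\<close> has
  position \<open>r - 1\<close>.\<close>

definition cyc :: "nat \<Rightarrow> nat" where
  "cyc s = Suc (s mod \<kappa>)"

lemma cyc_in: "cyc s \<in> J \<kappa>"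
  using kappa_pos by (simp add: cyc_def J_enat_iff Suc_le_eq)

lemma cyc_pred: "r \<in> J \<kappa> \<Longrightarrow> cyc (r - 1) = r"
  by (auto simp: cyc_def J_enat_iff)

lemma cyc_periodic: "cyc (s + \<kappa>) = cyc s"
  by (simp add: cyc_def)

lemma Circ_in_V: "Circ r \<in> V \<longleftrightarrow> r \<in> J \<kappa>"
  and Branch_in_V: "Branch r i j \<in> V \<longleftrightarrow> r \<in> J \<kappa> \<and> i \<in> J (\<eta> r) \<and> 1 \<le> j"
  by (auto simp: vertices_def J_infinity_iff)

lemma a_summable:
  assumes "r \<in> J \<kappa>" "1 \<le> j"
  shows "(\<lambda>i. a r i j) summable_on J (\<eta> r)"
  using assms(2)
proof (induction j rule: dec_induct)
  case base
  then show ?case using a_1_summable[OF assms(1)] by simp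
next
  case (step n)
  show ?case
    by (rule summable_on_comparison_test[OF summable_on_cmult_right[OF step.IH, of M]])
       (use assms(1) step.hyps in \<open>auto intro: a_ratio less_imp_le[OF a_pos]\<close>)
qed

text \<open>The total mass of the vertices at distance \<open>l\<close> from the circuit on the branches leaving
  position \<open>s\<close>.\<close>

definition branch_sum :: "nat \<Rightarrow> nat \<Rightarrow> real" where
  "branch_sum s l = (\<Sum>\<^sub>\<infinity>i\<in>J (\<eta> (cyc s)). a (cyc s) i l)"

text \<open>The total mass of all branch vertices that the \<open>n\<close>-th iterate of the parent map sends to
  position \<open>s\<close> of the circuit. A vertex sent there in \<open>n + 1\<close> steps either lies on a branch leaving
  \<open>s\<close>, at distance \<open>n + 1\<close>, or is sent to position \<open>s + 1\<close> in \<open>n\<close> steps.\<close>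

primrec branches_back :: "nat \<Rightarrow> nat \<Rightarrow> real" where
  "branches_back 0 s = 0"
| "branches_back (Suc n) s = branches_back n (Suc s) + branch_sum s (Suc n)"

lemma branch_sum_periodic: "branch_sum (s + \<kappa>) l = branch_sum s l"
  by (simp add: branch_sum_def cyc_periodic)

lemma branches_back_periodic: "branches_back n (s + \<kappa>) = branches_back n s"
  by (induction n arbitrary: s) (simp_all add: branch_sum_periodic flip: add_Suc)

lemma branch_sum_nonneg: "1 \<le> l \<Longrightarrow> 0 \<le> branch_sum s l"
  unfolding branch_sum_def by (intro infsum_nonneg less_imp_le[OF a_pos] cyc_in)

text \<open>The point masses given by \<open>c\<close> on the (unrolled) circuit and by \<open>a\<close> on the branches.\<close>

primrec weight :: "(nat \<Rightarrow> real) \<Rightarrow> vertex \<Rightarrow> real" where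
  "weight c (Circ r) = c (r - 1)"
| "weight c (Branch r i j) = a r i j"

lemma weight_pos: "(\<And>n. 0 < c n) \<Longrightarrow> v \<in> V \<Longrightarrow> 0 < weight c v"
  by (cases v) (auto simp: Circ_in_V Branch_in_V intro: a_pos)

lemma parent_eq_Circ_iff:
  assumes "v \<in> V"
  shows "parent \<kappa> v = Circ (cyc s) \<longleftrightarrow>
    v = Circ (cyc (Suc s)) \<or> (\<exists>i\<in>J (\<eta> (cyc s)). v = Branch (cyc s) i 1)"
proof (cases v)
  case (Circ r)
  then have "1 \<le> r" "r \<le> \<kappa>"
    using assms by (auto simp: Circ_in_V J_enat_iff)
  moreover have "s mod \<kappa> < \<kappa>"
    using kappa_pos by simp
  ultimately show ?thesis
    using Circ by (auto simp: parent_def cyc_def mod_Suc)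
qed (use assms in \<open>auto simp: parent_def Branch_in_V\<close>)

lemma parent_funpow_in_V: "v \<in> V \<Longrightarrow> (parent \<kappa> ^^ n) v \<in> V"
  by (induction n) (auto intro: parent_in_vertices)

lemma parent_funpow_eq_Branch_iff:
  assumes "v \<in> V" "1 \<le> j"
  shows "(parent \<kappa> ^^ n) v = Branch r i j \<longleftrightarrow> v = Branch r i (j + n)"
  using assms(2)
proof (induction n arbitrary: j)
  case (Suc n)
  have "(parent \<kappa> ^^ Suc n) v = Branch r i j \<longleftrightarrow> (parent \<kappa> ^^ n) v = Branch r i (Suc j)"
    using parent_funpow_in_V[OF assms(1), of n] Suc.prems
    by (cases "(parent \<kappa> ^^ n) v") (auto simp: parent_def Branch_in_V)
  then show ?case
    using Suc.IH[of "Suc j"] by simp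
qed simp

lemma weight_fibre_Branch:
  assumes "Branch r i j \<in> V"
  shows "(weight c has_sum a r i (j + n)) ((parent \<kappa> ^^ n) -` {Branch r i j} \<inter> V)"
proof -
  have "(parent \<kappa> ^^ n) -` {Branch r i j} \<inter> V = {Branch r i (j + n)}"
    using assms by (auto simp: parent_funpow_eq_Branch_iff Branch_in_V)
  then show ?thesis
    by (simp add: has_sum_finite_iff)
qed

lemma weight_fibre_Circ:
  assumes "\<And>n. c (n + \<kappa>) = c n"
  shows "(weight c has_sum c (s + n) + branches_back n s) ((parent \<kappa> ^^ n) -` {Circ (cyc s)} \<inter> V)"
proof (induction n arbitrary: s)
  case 0
  have "c (q + t * \<kappa>) = c q" for q t
    by (induction t) (auto simp: assms add.assoc[symmetric] add.commute[of \<kappa>])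
  then have "c (s mod \<kappa>) = c s"
    using mod_div_mult_eq[of s \<kappa>] by metis
  moreover have "(parent \<kappa> ^^ 0) -` {Circ (cyc s)} \<inter> V = {Circ (cyc s)}"
    using cyc_in by (auto simp: Circ_in_V)
  ultimately show ?case
    by (simp add: cyc_def has_sum_finite_iff)
next
  case (Suc n)
  define P where "P = (parent \<kappa> ^^ n) -` {Circ (cyc (Suc s))} \<inter> V"
  define Q where "Q = (\<lambda>i. Branch (cyc s) i (Suc n)) ` J (\<eta> (cyc s))"
  have "(weight c has_sum branch_sum s (Suc n)) Q"
    unfolding Q_def branch_sum_def
    by (subst has_sum_reindex) (auto simp: inj_on_def o_def intro!: has_sum_infsum a_summable cyc_in)
  moreover have "P \<inter> Q = {}"
    unfolding P_def Q_def using parent_funpow_eq_Branch_iff[of "Branch (cyc s) _ (Suc n)" 1 n]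
    by (fastforce simp: Branch_in_V cyc_in)
  ultimately have "(weight c has_sum c (Suc s + n) + branches_back n (Suc s) + branch_sum s (Suc n)) (P \<union> Q)"
    using Suc.IH[of "Suc s"] unfolding P_def by (intro has_sum_Un_disjoint)
  moreover have "(parent \<kappa> ^^ Suc n) -` {Circ (cyc s)} \<inter> V = P \<union> Q"
  proof -
    have "v \<in> (parent \<kappa> ^^ Suc n) -` {Circ (cyc s)} \<longleftrightarrow> v \<in> P \<union> Q" if v: "v \<in> V" for v
      using parent_eq_Circ_iff[OF parent_funpow_in_V[OF v, of n], of s] v
      by (auto simp: P_def Q_def parent_funpow_eq_Branch_iff)
    moreover have "P \<union> Q \<subseteq> V"
      by (auto simp: P_def Q_def Branch_in_V cyc_in)
    ultimately show ?thesis by blast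
  qed
  ultimately show ?case
    by (simp add: add_ac del: funpow.simps)
qed

lemma bounded_symbol_weight:
  assumes per: "\<And>n. c (n + \<kappa>) = c n" and pos: "\<And>n. 0 < c n"
  shows "\<exists>K. bounded_symbol V (weight c) (parent \<kappa>) K"
proof -
  define q where "q s = (c (Suc s) + branch_sum s 1) / c s" for s
  define K where "K = M + (\<Sum>s<\<kappa>. q s)"
  have q: "0 \<le> q s" for s
    using pos branch_sum_nonneg[of 1 s] by (simp add: q_def less_imp_le)
  have K: "M \<le> K" "s < \<kappa> \<Longrightarrow> q s \<le> K" for s
    using M_nonneg q member_le_sum[of s "{..<\<kappa>}" q] by (auto simp: K_def sum_nonneg add_increasing)
  have fib: "weight c summable_on (parent \<kappa> -` {v} \<inter> V) \<and>
      infsum (weight c) (parent \<kappa> -` {v} \<inter> V) \<le> K * weight c v" if v: "v \<in> V" for v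
  proof (cases v)
    case (Circ r)
    with v have r: "r \<in> J \<kappa>"
      by (simp add: Circ_in_V)
    then have r': "r - 1 < \<kappa>"
      by (auto simp: J_enat_iff)
    have "(weight c has_sum c (Suc (r - 1)) + branch_sum (r - 1) 1) (parent \<kappa> -` {v} \<inter> V)"
      using weight_fibre_Circ[where c = c and s = "r - 1" and n = 1, OF per] unfolding Circ cyc_pred[OF r] by simp
    moreover have "c (Suc (r - 1)) + branch_sum (r - 1) 1 \<le> K * weight c v"
      using K(2)[OF r'] pos[of "r - 1"] by (simp add: q_def Circ field_simps)
    ultimately show ?thesis
      by (auto simp: infsumI dest: has_sum_imp_summable)
  next
    case (Branch r i j)
    with v have rij: "r \<in> J \<kappa>" "i \<in> J (\<eta> r)" "1 \<le> j"
      by (auto simp: Branch_in_V)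
    have "(weight c has_sum a r i (Suc j)) (parent \<kappa> -` {v} \<inter> V)"
      using weight_fibre_Branch[of r i j c 1] v unfolding Branch by simp
    moreover have "a r i (Suc j) \<le> K * weight c v"
      using order_trans[OF a_ratio[OF rij] mult_right_mono[OF K(1)]] a_pos[OF rij]
      by (simp add: Branch less_imp_le)
    ultimately show ?thesis
      by (auto simp: infsumI dest: has_sum_imp_summable)
  qed
  have "bounded_symbol V (weight c) (parent \<kappa>) K"
    by unfold_locales (use fib in \<open>auto intro: weight_pos pos parent_in_vertices\<close>)
  then show ?thesis ..
qed

text \<open>The quasi-isometry condition splits into one finite-difference equation for each circuit
  position and one for each branch vertex.\<close>

lemma quasi_isometry_weight:
  assumes per: "\<And>n. c (n + \<kappa>) = c n" and pos: "\<And>n. 0 < c n"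
    and circ: "\<And>s. (fdiff ^^ m) c (s + k) + (fdiff ^^ m) (\<lambda>n. branches_back n s) k = 0"
    and branch: "\<And>r i j. \<lbrakk>r \<in> J \<kappa>; i \<in> J (\<eta> r); 1 \<le> j\<rbrakk> \<Longrightarrow> (fdiff ^^ m) (\<lambda>n. a r i (j + n)) k = 0"
  shows "\<exists>\<mu>. graph_measure \<kappa> \<eta> \<mu> \<and> (\<forall>v\<in>V. measure \<mu> {v} = weight c v) \<and>
    quasi_isometry_L2 \<mu> k m (composition_operator (parent \<kappa>))"
proof -
  obtain K where "bounded_symbol V (weight c) (parent \<kappa>) K"
    using bounded_symbol_weight[where c = c, OF per pos] by blast
  then interpret bounded_symbol V "weight c" "parent \<kappa>" K .
  have "(\<Sum>j=0..m. (-1) ^ j * real (m choose j) *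
      infsum (weight c) ((parent \<kappa> ^^ (k + (m - j))) -` {v} \<inter> V)) = 0" if v: "v \<in> V" for v
  proof (cases v)
    case (Circ r)
    with v have "r \<in> J \<kappa>"
      by (simp add: Circ_in_V)
    then have "infsum (weight c) ((parent \<kappa> ^^ n) -` {v} \<inter> V)
        = c (n + (r - 1)) + branches_back n (r - 1)" for n
      using weight_fibre_Circ[where c = c and s = "r - 1" and n = n, OF per] unfolding Circ cyc_pred[OF \<open>r \<in> J \<kappa>\<close>]
      by (simp add: infsumI add.commute)
    then have "(\<Sum>j=0..m. (-1) ^ j * real (m choose j) *
        infsum (weight c) ((parent \<kappa> ^^ (k + (m - j))) -` {v} \<inter> V))
        = (fdiff ^^ m) (\<lambda>n. c (n + (r - 1)) + branches_back n (r - 1)) k"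
      by (simp only: fdiff_funpow_eq_sum)
    also have "\<dots> = (fdiff ^^ m) c (r - 1 + k) + (fdiff ^^ m) (\<lambda>n. branches_back n (r - 1)) k"
      by (simp only: fdiff_funpow_add fdiff_funpow_shift[symmetric] add.commute[of k])
    finally show ?thesis
      using circ by simp
  next
    case (Branch r i j)
    with v have "infsum (weight c) ((parent \<kappa> ^^ n) -` {v} \<inter> V) = a r i (j + n)" for n
      using weight_fibre_Branch[of r i j c n] by (simp add: infsumI)
    then show ?thesis
      using branch[of r i j] v by (simp add: Branch Branch_in_V fdiff_funpow_eq_sum)
  qed
  then have "quasi_isometry_L2 \<mu> k m (composition_operator (parent \<kappa>))"
    by (rule quasi_isometryI)
  moreover have "graph_measure \<kappa> \<eta> \<mu>"
    by (simp add: graph_measure_def emeasure_mu_singleton p_pos)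
  ultimately show ?thesis
    using measure_mu_singleton by blast
qed

text \<open>The solvability condition for the circuit equations. Summed over the circuit, \<open>branches_back\<close>
  telescopes in \<open>n\<close>, which uses up one difference; the remaining \<open>m\<close> differences annihilate
  each branch separately.\<close>

lemma sum_fdiff_branches_back:
  assumes "\<And>r i. \<lbrakk>r \<in> J \<kappa>; i \<in> J (\<eta> r)\<rbrakk> \<Longrightarrow> (fdiff ^^ m) (\<lambda>n. a r i (Suc n)) k = 0"
  shows "(\<Sum>s<\<kappa>. (fdiff ^^ Suc m) (\<lambda>n. branches_back n s) k) = 0"
proof -
  define P where "P n = (\<Sum>s<\<kappa>. branches_back n s)" for n
  have "P (Suc n) = P n + (\<Sum>s<\<kappa>. branch_sum s (Suc n))" for n
    using sum_shift_periodic[where b = "branches_back n" and t = 1, OF branches_back_periodic]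
    by (simp add: P_def sum.distrib)
  then have P: "fdiff P = (\<lambda>n. \<Sum>s<\<kappa>. branch_sum s (Suc n))"
    by (simp add: fdiff_def fun_eq_iff)
  have "(\<Sum>s<\<kappa>. (fdiff ^^ Suc m) (\<lambda>n. branches_back n s) k) = (fdiff ^^ Suc m) P k"
    unfolding P_def by (rule fdiff_funpow_sum[symmetric])
  also have "\<dots> = (\<Sum>s<\<kappa>. (fdiff ^^ m) (\<lambda>n. branch_sum s (Suc n)) k)"
    by (simp only: funpow_Suc_right o_apply P fdiff_funpow_sum)
  also have "\<dots> = 0"
  proof (intro sum.neutral ballI)
    fix s
    have "(fdiff ^^ m) (\<lambda>n. branch_sum s (Suc n)) k
        = (\<Sum>\<^sub>\<infinity>i\<in>J (\<eta> (cyc s)). (fdiff ^^ m) (\<lambda>n. a (cyc s) i (Suc n)) k)"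
      unfolding branch_sum_def by (rule fdiff_funpow_infsum) (intro a_summable cyc_in, simp)
    also have "\<dots> = 0"
      by (intro infsum_0 assms cyc_in)
    finally show "(fdiff ^^ m) (\<lambda>n. branch_sum s (Suc n)) k = 0" .
  qed
  finally show ?thesis .
qed

lemma circuit_weights_exist:
  assumes "\<And>r i. \<lbrakk>r \<in> J \<kappa>; i \<in> J (\<eta> r)\<rbrakk> \<Longrightarrow> (fdiff ^^ m) (\<lambda>n. a r i (Suc n)) k = 0"
  shows "\<exists>c. (\<forall>n. c (n + \<kappa>) = c n) \<and> (\<forall>n. 0 < c n) \<and>
    (\<forall>s. (fdiff ^^ Suc m) c (s + k) + (fdiff ^^ Suc m) (\<lambda>n. branches_back n s) k = 0)"
proof -
  define b where "b s = (fdiff ^^ Suc m) (\<lambda>n. branches_back n s) k" for s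
  have b: "b (s + \<kappa>) = b s" for s
    by (simp only: b_def branches_back_periodic)
  have b': "b (s + t * \<kappa>) = b s" for s t
    by (induction t) (auto simp: b add.assoc[symmetric] add.commute[of \<kappa>])
  \<comment> \<open>The equation asks for the difference at \<open>s + k\<close>, so \<open>b\<close> is shifted back by \<open>k\<close>, modulo \<open>\<kappa>\<close>.\<close>
  define e where "e s = - b (s + (\<kappa> * k - k))" for s
  have "e (s + \<kappa>) = e s" for s
    using b[of "s + (\<kappa> * k - k)"] by (simp add: e_def add_ac)
  moreover have "(\<Sum>s<\<kappa>. e s) = 0"
    unfolding e_def sum_negf sum_shift_periodic[where b = b, OF b]
    using sum_fdiff_branches_back[OF assms] by (simp add: b_def del: funpow.simps)
  ultimately obtain d where d: "\<And>n. d (n + \<kappa>) = d n" "\<And>n. (fdiff ^^ Suc m) d n = e n"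
    using periodic_fdiff_solvable[OF kappa_pos] by metis
  \<comment> \<open>Constants are in the kernel of the difference operator and can be used to reach positivity.\<close>
  define C where "C = 1 + (\<Sum>s<\<kappa>. \<bar>d s\<bar>)"
  define c where "c n = d n + C" for n
  have "d (q + t * \<kappa>) = d q" for q t
    by (induction t) (auto simp: d(1) add.assoc[symmetric] add.commute[of \<kappa>])
  then have dmod: "d n = d (n mod \<kappa>)" for n
    using mod_div_mult_eq[of n \<kappa>] by metis
  have "0 < c n" for n
    using member_le_sum[of "n mod \<kappa>" "{..<\<kappa>}" "\<lambda>s. \<bar>d s\<bar>"] kappa_pos dmod[of n]
    by (simp add: c_def C_def)
  moreover have "c (n + \<kappa>) = c n" for n
    by (simp add: c_def d)
  moreover have "(fdiff ^^ Suc m) c (s + k) + b s = 0" for s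
  proof -
    have "(fdiff ^^ Suc m) c (s + k) = e (s + k)"
      unfolding c_def fdiff_funpow_add d(2) by (simp add: fdiff_funpow_const del: funpow.simps)
    also have "\<dots> = - b s"
      using kappa_pos b'[of s k] by (simp add: e_def mult.commute add.assoc)
    finally show ?thesis by simp
  qed
  ultimately show ?thesis
    unfolding b_def by blast
qed

end

lemma summable_on_if_infsum_ennreal_le:
  fixes f :: "'a \<Rightarrow> real"
  assumes "\<And>x. x \<in> S \<Longrightarrow> 0 \<le> f x" "(\<Sum>\<^sub>\<infinity>x\<in>S. ennreal (f x)) \<le> ennreal B" "0 \<le> B"
  shows "f summable_on S"
proof (rule nonneg_bdd_above_summable_on)
  show "bdd_above (sum f ` {F. F \<subseteq> S \<and> finite F})"
  proof (rule bdd_aboveI2)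
    fix F assume F: "F \<in> {F. F \<subseteq> S \<and> finite F}"
    then have "ennreal (sum f F) = (\<Sum>x\<in>F. ennreal (f x))"
      using assms(1) by (subst sum_ennreal) auto
    also have "\<dots> \<le> (\<Sum>\<^sub>\<infinity>x\<in>S. ennreal (f x))"
      using F by (auto simp: nonneg_infsum_complete intro: SUP_upper)
    finally show "sum f F \<le> B"
      using assms(2,3) by (metis ennreal_le_iff order_trans)
  qed
qed (use assms in auto)

section \<open>Existence of the measures\<close>

theorem theorem2p6:
  fixes m \<kappa> k :: nat
    and \<eta> :: "nat \<Rightarrow> enat"
    and M :: real
    and w :: "nat \<Rightarrow> nat \<Rightarrow> real poly"
    and a :: "nat \<Rightarrow> nat \<Rightarrow> nat \<Rightarrow> real"
  assumes "\<kappa> > m" and "m \<ge> 2" and "k \<ge> 1"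
    and "\<exists>r\<in>J \<kappa>. \<eta> r \<noteq> 0"
    and "M > 0"
    and "\<And>r i. r \<in> J \<kappa> \<Longrightarrow> i \<in> J (\<eta> r) \<Longrightarrow> degree (w r i) \<le> m - 2"
    and "\<And>r i j. r \<in> J \<kappa> \<Longrightarrow> i \<in> J (\<eta> r) \<Longrightarrow> j \<in> J \<infinity> \<Longrightarrow> a r i j > 0"
    and "\<And>r i j. r \<in> J \<kappa> \<Longrightarrow> i \<in> J (\<eta> r) \<Longrightarrow> j \<in> J \<infinity> \<Longrightarrow>
           poly (w r i) (real j) = a r i (k + j)"
    and "(MAX r\<in>J \<kappa>. max (\<Sum>\<^sub>\<infinity>i\<in>J (\<eta> r). ennreal (a r i 1))
            (SUP (i, j)\<in>J (\<eta> r) \<times> J \<infinity>. ennreal (a r i (j + 1) / a r i j))) \<le> ennreal M"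
  shows "\<exists>\<mu>. graph_measure \<kappa> \<eta> \<mu> \<and>
           (\<forall>r\<in>J \<kappa>. \<forall>i\<in>J (\<eta> r). \<forall>j\<in>J \<infinity>. measure \<mu> {Branch r i j} = a r i j) \<and>
           quasi_isometry_L2 \<mu> k m (composition_operator (parent \<kappa>)) \<and>
           (\<exists>c::real. \<forall>t>c. \<exists>\<mu>\<^sub>t. graph_measure \<kappa> \<eta> \<mu>\<^sub>t \<and>
              (\<forall>r\<in>J \<kappa>. \<forall>i\<in>J (\<eta> r). \<forall>j\<in>J \<infinity>. measure \<mu>\<^sub>t {Branch r i j} = a r i j) \<and>
              quasi_isometry_L2 \<mu>\<^sub>t k m (composition_operator (parent \<kappa>)) \<and>
              (\<forall>x\<in>vertices \<kappa> \<eta>. measure \<mu>\<^sub>t {x} =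
                 (if \<exists>r\<in>J \<kappa>. x = Circ r then measure \<mu> {x} + t else measure \<mu> {x})))"
proof -
  have finJ: "finite (J \<kappa>)"
    by (rule finite_subset[of _ "{..\<kappa>}"]) (auto simp: J_enat_iff)
  have bound: "max (\<Sum>\<^sub>\<infinity>i\<in>J (\<eta> r). ennreal (a r i 1))
      (SUP (i, j)\<in>J (\<eta> r) \<times> J \<infinity>. ennreal (a r i (j + 1) / a r i j)) \<le> ennreal M"
    if "r \<in> J \<kappa>" for r
    using assms(9) by (rule order_trans[OF Max_ge, rotated 2]) (use finJ that in auto)
  interpret one_circuit \<kappa> \<eta> a M
  proof
    fix r i j :: nat
    assume r: "r \<in> J \<kappa>"
    show "(\<lambda>i. a r i 1) summable_on J (\<eta> r)"
      using bound[OF r] assms(5,7) r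
      by (intro summable_on_if_infsum_ennreal_le[where B = M]) (auto simp: less_imp_le J_infinity_iff)
    assume i: "i \<in> J (\<eta> r)" and j: "1 \<le> j"
    show pos: "0 < a r i j"
      using assms(7)[OF r i] j by (simp add: J_infinity_iff)
    have "ennreal (a r i (j + 1) / a r i j) \<le> (SUP (i, j)\<in>J (\<eta> r) \<times> J \<infinity>. ennreal (a r i (j + 1) / a r i j))"
      by (rule SUP_upper2[of "(i, j)"]) (use i j in \<open>auto simp: J_infinity_iff\<close>)
    also have "\<dots> \<le> ennreal M"
      using bound[OF r] by simp
    finally show "a r i (Suc j) \<le> M * a r i j"
      using assms(5) pos by (simp add: ennreal_le_iff field_simps)
  qed (use assms(1,5) in auto)
  have tail: "(fdiff ^^ n) (\<lambda>l. a r i (j + l)) k = 0"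
    if "r \<in> J \<kappa>" "i \<in> J (\<eta> r)" "1 \<le> j" "m - 1 \<le> n" for r i j n
  proof -
    have "(fdiff ^^ n) (\<lambda>l. a r i (j + l)) (0 + k) = (fdiff ^^ n) (\<lambda>l. a r i (k + (l + j))) 0"
      unfolding fdiff_funpow_shift by (simp add: add_ac)
    also have "\<dots> = (fdiff ^^ n) (\<lambda>l. poly (w r i) (real (l + j))) 0"
      using that by (subst assms(8)) (auto simp: J_infinity_iff)
    also have "\<dots> = (fdiff ^^ n) (\<lambda>l. poly (w r i) (real l)) (0 + j)"
      by (simp only: fdiff_funpow_shift)
    also have "\<dots> = 0"
      using assms(2) assms(6)[OF that(1,2)] that(4) by (intro fdiff_funpow_poly) linarith
    finally show ?thesis by simp
  qed
  have m: "m = Suc (m - 1)"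
    using assms(2) by simp
  obtain c where per: "\<And>n. c (n + \<kappa>) = c n" and pos: "\<And>n. 0 < c n"
    and circ: "\<And>s. (fdiff ^^ m) c (s + k) + (fdiff ^^ m) (\<lambda>n. branches_back n s) k = 0"
    using circuit_weights_exist[of "m - 1" k] tail[of _ _ 1 "m - 1"] m by fastforce
  \<comment> \<open>Since \<open>c\<close> may be replaced by \<open>c + t\<close>, the threshold can be taken to be \<open>0\<close>.\<close>
  have ex: "\<exists>\<mu>. graph_measure \<kappa> \<eta> \<mu> \<and> (\<forall>v\<in>V. measure \<mu> {v} = weight (\<lambda>n. c n + t) v) \<and>
      quasi_isometry_L2 \<mu> k m (composition_operator (parent \<kappa>))" if "0 \<le> t" for t
  proof (rule quasi_isometry_weight)
    show "c (n + \<kappa>) + t = c n + t" for n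
      by (simp add: per)
    show "0 < c n + t" for n
      using pos[of n] that by simp
    show "(fdiff ^^ m) (\<lambda>n. c n + t) (s + k) + (fdiff ^^ m) (\<lambda>n. branches_back n s) k = 0" for s
      using circ[of s] assms(2) by (simp add: fdiff_funpow_add fdiff_funpow_const)
    show "(fdiff ^^ m) (\<lambda>n. a r i (j + n)) k = 0"
      if "r \<in> J \<kappa>" "i \<in> J (\<eta> r)" "1 \<le> j" for r i j
      using tail[OF that] by simp
  qed
  obtain \<mu> where \<mu>: "graph_measure \<kappa> \<eta> \<mu>" "\<forall>v\<in>V. measure \<mu> {v} = weight (\<lambda>n. c n + 0) v"
    "quasi_isometry_L2 \<mu> k m (composition_operator (parent \<kappa>))"
    using ex[of 0] by auto
  have \<mu>t: "\<exists>\<mu>\<^sub>t. graph_measure \<kappa> \<eta> \<mu>\<^sub>t \<and>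
      (\<forall>r\<in>J \<kappa>. \<forall>i\<in>J (\<eta> r). \<forall>j\<in>J \<infinity>. measure \<mu>\<^sub>t {Branch r i j} = a r i j) \<and>
      quasi_isometry_L2 \<mu>\<^sub>t k m (composition_operator (parent \<kappa>)) \<and>
      (\<forall>x\<in>vertices \<kappa> \<eta>. measure \<mu>\<^sub>t {x} =
         (if \<exists>r\<in>J \<kappa>. x = Circ r then measure \<mu> {x} + t else measure \<mu> {x}))" if t: "t > 0" for t
  proof -
    obtain \<nu> where \<nu>: "graph_measure \<kappa> \<eta> \<nu>" "\<forall>v\<in>V. measure \<nu> {v} = weight (\<lambda>n. c n + t) v"
      "quasi_isometry_L2 \<nu> k m (composition_operator (parent \<kappa>))"
      using ex[of t] t by auto
    have "measure \<nu> {x} = (if \<exists>r\<in>J \<kappa>. x = Circ r then measure \<mu> {x} + t else measure \<mu> {x})"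
      if "x \<in> V" for x
      using that \<mu>(2) \<nu>(2) by (cases x) (auto simp: Circ_in_V)
    moreover have "\<forall>r\<in>J \<kappa>. \<forall>i\<in>J (\<eta> r). \<forall>j\<in>J \<infinity>. measure \<nu> {Branch r i j} = a r i j"
      using \<nu>(2) by (simp add: Branch_in_V J_infinity_iff)
    ultimately show ?thesis
      using \<nu>(1,3) by blast
  qed
  have "\<forall>r\<in>J \<kappa>. \<forall>i\<in>J (\<eta> r). \<forall>j\<in>J \<infinity>. measure \<mu> {Branch r i j} = a r i j"
    using \<mu>(2) by (auto simp: Branch_in_V J_infinity_iff)
  then show ?thesis
    using \<mu>(1,3) \<mu>t by blast
qed

end
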